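(* The monomial Krull dimension function $I\mapsto \operatorname{m-dim}(R/I)$ is lower semicontinuous, with respect to $\operatorname{dist}$, on the set of finitely generated monomial ideals of $R=A[\mathbb{M}^1_{\geq 0}\times\cdots\times\mathbb{M}^d_{\geq 0}]$.
   Context: $A$ is a non-zero commutative ring with identity, $d$ is a positive integer, and $\mathbb{M}^1,\ldots,\mathbb{M}^d$ are non-zero additive subgroups of $\mathbb{R}$. Set $\mathbb{M}^i_{\geq 0}=\{m\in\mathbb{M}^i\mid m\geq 0\}$ and $\mathbb{M}^i_{>0}=\{m\in\mathbb{M}^i\mid m>0\}$. The semigroup ring $R=A[\mathbb{M}^1_{\geq 0}\times\cdots\times\mathbb{M}^d_{\geq 0}]$ is the set of all finite $A$-linear combinations of monomials $\underline{X}^{\underline{m}}=X_1^{m_1}\cdots X_d^{m_d}$ with $\underline{m}\in\mathbb{M}^1_{\geq 0}\times\cdots\times\mathbb{M}^d_{\geq 0}$ (multiplication adds exponents). A monomial ideal of $R$ is an ideal generated by a (possibly empty) set of monomials. A monomial ideal $P\subsetneq R$ is m-prime if for all monomials $f,g\in R$, $fg\in P$ implies $f\in P$ or $g\in P$. The m-prime ideals are exactly the ideals $Q_T=(X_i^n\mid i\in T,\ n\in\mathbb{M}^i_{>0})R$ with $T\subseteq\{1,\ldots,d\}$. For $P=Q_T$ put $v(P)=|T|$ and $\operatorname{m-dim}^*(R/P)=d-v(P)$. The monomial Krull dimension of a monomial ideal $I$ is $$\operatorname{m-dim}(R/I)=\sup\{\operatorname{m-dim}^*(R/Q)\mid Q\text{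 is m-prime and }Q\supseteq I\},$$ with $\operatorname{m-dim}(R/R)=\sup\emptyset=-\infty$. For monomial ideals $I,J$ of $R$ and a real number $\varepsilon>0$, one says "$\operatorname{dist}(I,J)<\varepsilon$" if (1) for every monomial $\underline{X}^{\underline{\gamma}}\in I$ there exists a monomial $\underline{X}^{\underline{\delta}}\in J$ with $|\underline{\gamma}-\underline{\delta}|<\varepsilon$, and (2) for every monomial $\underline{X}^{\underline{\delta}'}\in J$ there exists a monomial $\underline{X}^{\underline{\gamma}'}\in I$ with $|\underline{\delta}'-\underline{\gamma}'|<\varepsilon$, where $|\cdot|$ is the Euclidean norm on $\mathbb{R}^d$. The distance is $\operatorname{dist}(I,J)=\inf\{\varepsilon>0\mid\text{(1) and (2) hold for }I,J,\varepsilon\}$, with $\inf\emptyset=\infty$; thus $\operatorname{dist}(0,0)=0$ and $\operatorname{dist}(I,0)=\infty$ for $I\neq 0$. Since $\operatorname{m-dim}$ takes values in the finite set $\{-\infty,0,1,\ldots,d\}$, lower semicontinuity at $I$ means: there is $\varepsilon>0$ such that every finitely generated monomial ideal $J$ with $\operatorname{dist}(I,J)<\varepsilon$ satisfies $\operatorname{m-dim}(R/J)\geq\operatorname{m-dim}(R/I)$. *)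

theory Defs
  imports
    "HOL-Analysis.Analysis"
    "HOL-Library.Poly_Mapping"
    "HOL-Algebra.Ideal"
begin

text \<open>
  The coefficient ring is a type \<open>'a :: comm_ring_1\<close> (so \<open>0 \<noteq> 1\<close>), the variables are indexed by a
  finite type \<open>'d\<close> (so \<open>d = CARD('d) \<ge> 1\<close>), and exponent vectors live in \<open>real ^ 'd\<close>, whose norm is
  the Euclidean one. Finitely supported functions \<open>(real ^ 'd) \<Rightarrow>\<^sub>0 'a\<close> with the convolution product
  form the monoid algebra over all real exponents; \<open>R\<close> is cut out of it by restricting the support.
\<close>

definition additive_real_subgroup :: "real set \<Rightarrow> bool" where
  "additive_real_subgroup G \<longleftrightarrow>
     0 \<in> G \<and> (\<forall>x\<in>G. \<forall>y\<in>G. x + y \<in> G) \<and> (\<forall>x\<in>G. - x \<in> G)"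

definition exponents :: "('d::finite \<Rightarrow> real set) \<Rightarrow> (real ^ 'd) set" where
  "exponents M = {m. \<forall>i. m $ i \<in> M i \<and> 0 \<le> m $ i}"

definition semigroup_ring ::
    "('d::finite \<Rightarrow> real set) \<Rightarrow> ((real ^ 'd) \<Rightarrow>\<^sub>0 'a::comm_ring_1) ring" where
  "semigroup_ring M =
     \<lparr>carrier = {f. Poly_Mapping.keys f \<subseteq> exponents M},
      mult = (*), one = 1, zero = 0, add = (+)\<rparr>"

abbreviation monom :: "real ^ 'd::finite \<Rightarrow> (real ^ 'd) \<Rightarrow>\<^sub>0 'a::comm_ring_1" where
  "monom m \<equiv> Poly_Mapping.single m 1"

definition monomials :: "('d::finite \<Rightarrow> real set) \<Rightarrow> ((real ^ 'd) \<Rightarrow>\<^sub>0 'a::comm_ring_1) set" where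
  "monomials M = monom ` exponents M"

lemma cring_semigroup_ring:
  fixes M :: "'d::finite \<Rightarrow> real set"
  assumes M: "\<And>i. additive_real_subgroup (M i)"
  shows "cring (semigroup_ring M :: ((real ^ 'd) \<Rightarrow>\<^sub>0 'a::comm_ring_1) ring)"
proof -
  have add: "a + b \<in> exponents M" if "a \<in> exponents M" "b \<in> exponents M" for a b
    using that M unfolding exponents_def additive_real_subgroup_def by auto
  have zero: "0 \<in> exponents M"
    using M unfolding exponents_def additive_real_subgroup_def by auto
  have kmult: "Poly_Mapping.keys (f * g) \<subseteq> exponents M"
    if "Poly_Mapping.keys f \<subseteq> exponents M" "Poly_Mapping.keys g \<subseteq> exponents M"
    for f g :: "(real ^ 'd) \<Rightarrow>\<^sub>0 'a"
    using that keys_mult[of f g] add by blast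
  have kadd: "Poly_Mapping.keys (f + g) \<subseteq> exponents M"
    if "Poly_Mapping.keys f \<subseteq> exponents M" "Poly_Mapping.keys g \<subseteq> exponents M"
    for f g :: "(real ^ 'd) \<Rightarrow>\<^sub>0 'a"
    using that Poly_Mapping.keys_add[of f g] by blast
  show ?thesis
  proof (rule cringI)
    show "abelian_group (semigroup_ring M :: ((real ^ 'd) \<Rightarrow>\<^sub>0 'a) ring)"
    proof (rule abelian_groupI, goal_cases)
      case (6 x)
      then show ?case
        by (intro bexI[of _ "- x"]) (auto simp: semigroup_ring_def)
    qed (use kadd in \<open>auto simp: semigroup_ring_def algebra_simps\<close>)
    show "comm_monoid (semigroup_ring M :: ((real ^ 'd) \<Rightarrow>\<^sub>0 'a) ring)"
      by (rule comm_monoidI) (use kmult zero in \<open>auto simp: semigroup_ring_def algebra_simps\<close>)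
  qed (auto simp: semigroup_ring_def algebra_simps)
qed

definition monomial_ideal ::
    "('d::finite \<Rightarrow> real set) \<Rightarrow> ((real ^ 'd) \<Rightarrow>\<^sub>0 'a::comm_ring_1) set \<Rightarrow> bool" where
  "monomial_ideal M I \<longleftrightarrow> (\<exists>S \<subseteq> monomials M. I = genideal (semigroup_ring M) S)"

text \<open>Finite generation is that of an ideal: the finitely many generators need not be monomials.\<close>

definition fg_monomial_ideals ::
    "('d::finite \<Rightarrow> real set) \<Rightarrow> ((real ^ 'd) \<Rightarrow>\<^sub>0 'a::comm_ring_1) set set" where
  "fg_monomial_ideals M =
     {I. monomial_ideal M I \<and>
         (\<exists>S \<subseteq> carrier (semigroup_ring M). finite S \<and> I = genideal (semigroup_ring M) S)}"

definition m_prime ::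
    "('d::finite \<Rightarrow> real set) \<Rightarrow> ((real ^ 'd) \<Rightarrow>\<^sub>0 'a::comm_ring_1) set \<Rightarrow> bool" where
  "m_prime M P \<longleftrightarrow>
     monomial_ideal M P \<and> P \<noteq> carrier (semigroup_ring M) \<and>
     (\<forall>f\<in>monomials M. \<forall>g\<in>monomials M. f * g \<in> P \<longrightarrow> f \<in> P \<or> g \<in> P)"

definition Q_ideal ::
    "('d::finite \<Rightarrow> real set) \<Rightarrow> 'd set \<Rightarrow> ((real ^ 'd) \<Rightarrow>\<^sub>0 'a::comm_ring_1) set" where
  "Q_ideal M T = genideal (semigroup_ring M) {monom (axis i n) | i n. i \<in> T \<and> n \<in> M i \<and> 0 < n}"

text \<open>
  When every \<open>M i\<close> is a non-zero additive subgroup, \<open>Q_ideal M\<close> is injective and its values are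
  exactly the m-prime ideals, so the description below determines a unique \<open>T\<close> for each m-prime \<open>P\<close>.
\<close>

definition v_count :: "('d::finite \<Rightarrow> real set) \<Rightarrow> ((real ^ 'd) \<Rightarrow>\<^sub>0 'a::comm_ring_1) set \<Rightarrow> nat" where
  "v_count M P = card (THE T. P = Q_ideal M T)"

definition m_dim_star ::
    "('d::finite \<Rightarrow> real set) \<Rightarrow> ((real ^ 'd) \<Rightarrow>\<^sub>0 'a::comm_ring_1) set \<Rightarrow> int" where
  "m_dim_star M P = int CARD('d) - int (v_count M P)"

text \<open>
  \<open>m_dim M I\<close> and \<open>m_dim_star M P\<close> stand for the dimensions of the quotients \<open>R/I\<close> and \<open>R/P\<close>.
  In \<open>ereal\<close> the supremum of the empty set is \<open>-\<infinity>\<close> and the infimum of the empty set is \<open>\<infinity>\<close>.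
\<close>

definition m_dim ::
    "('d::finite \<Rightarrow> real set) \<Rightarrow> ((real ^ 'd) \<Rightarrow>\<^sub>0 'a::comm_ring_1) set \<Rightarrow> ereal" where
  "m_dim M I = (SUP Q \<in> {Q. m_prime M Q \<and> I \<subseteq> Q}. ereal (of_int (m_dim_star M Q)))"

definition within_dist ::
    "('d::finite \<Rightarrow> real set) \<Rightarrow> ((real ^ 'd) \<Rightarrow>\<^sub>0 'a::comm_ring_1) set \<Rightarrow>
     ((real ^ 'd) \<Rightarrow>\<^sub>0 'a) set \<Rightarrow> real \<Rightarrow> bool" where
  "within_dist M I J \<epsilon> \<longleftrightarrow>
     (\<forall>\<gamma>\<in>exponents M. monom \<gamma> \<in> I \<longrightarrow>
        (\<exists>\<delta>\<in>exponents M. monom \<delta> \<in> J \<and> norm (\<gamma> - \<delta>) < \<epsilon>)) \<and>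
     (\<forall>\<delta>\<in>exponents M. monom \<delta> \<in> J \<longrightarrow>
        (\<exists>\<gamma>\<in>exponents M. monom \<gamma> \<in> I \<and> norm (\<delta> - \<gamma>) < \<epsilon>))"

definition ideal_dist ::
    "('d::finite \<Rightarrow> real set) \<Rightarrow> ((real ^ 'd) \<Rightarrow>\<^sub>0 'a::comm_ring_1) set \<Rightarrow>
     ((real ^ 'd) \<Rightarrow>\<^sub>0 'a) set \<Rightarrow> ereal" where
  "ideal_dist M I J = Inf {ereal \<epsilon> | \<epsilon>. 0 < \<epsilon> \<and> within_dist M I J \<epsilon>}"

text \<open>
  The \<open>\<epsilon>\<close>-form of lower semicontinuity with \<open>f I \<le> f J\<close> is the usual one for functions that,
  like \<open>m_dim M\<close>, take only finitely many values.
\<close>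

definition lower_semicontinuous_wrt ::
    "('b \<Rightarrow> 'b \<Rightarrow> ereal) \<Rightarrow> 'b set \<Rightarrow> ('b \<Rightarrow> ereal) \<Rightarrow> bool" where
  "lower_semicontinuous_wrt \<rho> X f \<longleftrightarrow>
     (\<forall>I\<in>X. \<exists>\<epsilon>::real. 0 < \<epsilon> \<and> (\<forall>J\<in>X. \<rho> I J < ereal \<epsilon> \<longrightarrow> f I \<le> f J))"

end

theory Submission
  imports Defs
begin

text \<open>
  Let \<open>I\<close> be a finitely generated monomial ideal. Together with any element \<open>I\<close> contains the
  monomials that occur in it, so the finitely many monomials occurring in finitely many generators
  lie in \<open>I\<close> and divide all monomials of \<open>I\<close> (\<open>fg_monomial_ideal_dominating_monomials\<close>). Let \<open>\<epsilon>\<close>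
  be the minimum of 1 and the positive coordinates of their exponent vectors \<open>g\<close>.

  If an m-prime \<open>Q\<close> contains \<open>I\<close>, then each \<open>g\<close> has a positive coordinate at some variable \<open>X\<^sub>i\<close>
  having a power in \<open>Q\<close> (\<open>m_prime_contains_pure_power\<close>), so in every monomial of \<open>I\<close> some such
  variable has exponent at least \<open>\<epsilon>\<close>. Moving the exponent vector by less than \<open>\<epsilon>\<close> leaves that
  exponent positive, and an m-prime containing one power of \<open>X\<^sub>i\<close> contains every monomial in which
  \<open>X\<^sub>i\<close> occurs (\<open>m_prime_absorbs_variable\<close>). Hence every monomial ideal at distance less than \<open>\<epsilon>\<close>
  from \<open>I\<close> is contained in every m-prime that contains \<open>I\<close>, and the supremum defining its
  dimension runs over a larger set.
\<close>

section \<open>The semigroup ring and its exponent vectors\<close>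

lemma carrier_semigroup_ring [simp]:
  "f \<in> carrier (semigroup_ring M) \<longleftrightarrow> Poly_Mapping.keys f \<subseteq> exponents M"
  by (simp add: semigroup_ring_def)

lemma mult_semigroup_ring [simp]: "mult (semigroup_ring M) = (*)"
  by (simp add: semigroup_ring_def)

lemma one_semigroup_ring [simp]: "one (semigroup_ring M) = 1"
  by (simp add: semigroup_ring_def)

lemma add_semigroup_ring [simp]: "add (semigroup_ring M) = (+)"
  by (simp add: semigroup_ring_def)

lemma zero_semigroup_ring [simp]: "zero (semigroup_ring M) = 0"
  by (simp add: semigroup_ring_def)

lemma monomials_subset_carrier: "monomials M \<subseteq> carrier (semigroup_ring M)"
  by (auto simp: monomials_def)

lemma monom_in_monomials: "x \<in> exponents M \<Longrightarrow> monom x \<in> monomials M"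
  by (simp add: monomials_def)

lemma monom_add: "monom (x + y) = monom x * monom y"
  by (simp add: mult_single)

context
  fixes M :: "'d::finite \<Rightarrow> real set"
  assumes subgroup: "\<And>i. additive_real_subgroup (M i)"
begin

lemma exponents_zero: "0 \<in> exponents M"
  using subgroup by (auto simp: exponents_def additive_real_subgroup_def)

lemma exponents_add: "x \<in> exponents M \<Longrightarrow> y \<in> exponents M \<Longrightarrow> x + y \<in> exponents M"
  using subgroup by (auto simp: exponents_def additive_real_subgroup_def)

text \<open>
  Divisibility of monomials is the coordinatewise order of exponent vectors because \<open>M i\<close> is a
  group and not just a monoid: the difference is again an admissible exponent vector.
\<close>

lemma exponents_diff:
  assumes "x \<in> exponents M" "y \<in> exponents M" "\<And>i. y $ i \<le> x $ i"
  shows "x - y \<in> exponents M"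
proof -
  have "x $ i + - (y $ i) \<in> M i" for i
    using assms(1,2) subgroup[of i] unfolding exponents_def additive_real_subgroup_def by blast
  then show ?thesis
    using assms(3) by (auto simp: exponents_def)
qed

lemma exponents_scale: "x \<in> exponents M \<Longrightarrow> real k *\<^sub>R x \<in> exponents M"
  by (induction k) (auto simp: exponents_zero algebra_simps intro: exponents_add)

lemma exponents_axis: "x \<in> exponents M \<Longrightarrow> axis i (x $ i) \<in> exponents M"
  using subgroup by (auto simp: exponents_def additive_real_subgroup_def axis_def)

lemma exponents_sum: "(\<And>i. i \<in> F \<Longrightarrow> f i \<in> exponents M) \<Longrightarrow> sum f F \<in> exponents M"
  by (induction F rule: infinite_finite_induct) (auto simp: exponents_zero intro: exponents_add)

interpretation semigroup_ring: cring "semigroup_ring M"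
  by (rule cring_semigroup_ring) (rule subgroup)

lemma ideal_mult_monom:
  assumes "ideal I (semigroup_ring M)" "monom x \<in> I" "y \<in> exponents M"
  shows "monom (x + y) \<in> I"
  using ideal.I_r_closed[OF assms(1,2), of "monom y"] assms(3) by (simp add: monom_add)

section \<open>Generators of monomial ideals\<close>

text \<open>
  The elements supported on a fixed set of exponents form an ideal as soon as that set is closed
  under adding exponent vectors. Applied to arbitrary generators, this is what allows the
  generators of a finitely generated ideal to be replaced by the monomials that occur in them.
\<close>

lemma keys_genideal:
  fixes S :: "((real ^ 'd) \<Rightarrow>\<^sub>0 'a::comm_ring_1) set"
  assumes "S \<subseteq> carrier (semigroup_ring M)" "f \<in> genideal (semigroup_ring M) S"
    and "x \<in> Poly_Mapping.keys f"
  shows "\<exists>s\<in>S. \<exists>g\<in>Poly_Mapping.keys s. \<exists>e\<in>exponents M. x = g + e"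
proof -
  define U where "U = {g + e | g e s. s \<in> S \<and> g \<in> Poly_Mapping.keys s \<and> e \<in> exponents M}"
  have U_exponents: "U \<subseteq> exponents M"
    using assms(1) by (fastforce simp: U_def intro: exponents_add)
  have U_add: "u + e \<in> U" if "u \<in> U" "e \<in> exponents M" for u e
    using that unfolding U_def by clarsimp (metis exponents_add add.assoc)
  have U_mult: "Poly_Mapping.keys (a * b) \<subseteq> U"
    if "Poly_Mapping.keys a \<subseteq> U" "Poly_Mapping.keys b \<subseteq> exponents M"
    for a b :: "(real ^ 'd) \<Rightarrow>\<^sub>0 'a"
    using keys_mult[of a b] that U_add by blast
  define K where "K = {a :: (real ^ 'd) \<Rightarrow>\<^sub>0 'a. Poly_Mapping.keys a \<subseteq> U}"
  have "ideal K (semigroup_ring M)"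
  proof (rule idealI)
    show "ring (semigroup_ring M :: ((real ^ 'd) \<Rightarrow>\<^sub>0 'a) ring)"
      by (rule semigroup_ring.ring_axioms)
    show "subgroup K (add_monoid (semigroup_ring M))"
    proof (rule semigroup_ring.add.subgroupI)
      show "K \<subseteq> carrier (semigroup_ring M)"
        using U_exponents by (auto simp: K_def)
      show "K \<noteq> {}"
        by (auto simp: K_def intro: exI[of _ 0])
    next
      fix a assume a: "a \<in> K"
      then have "a \<in> carrier (semigroup_ring M)"
        using U_exponents by (auto simp: K_def)
      then have "\<ominus>\<^bsub>semigroup_ring M\<^esub> a = - a"
        by (intro semigroup_ring.minus_equality) auto
      then show "\<ominus>\<^bsub>semigroup_ring M\<^esub> a \<in> K"
        using a by (simp add: K_def)
    next
      fix a b assume "a \<in> K" "b \<in> K"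
      then show "a \<oplus>\<^bsub>semigroup_ring M\<^esub> b \<in> K"
        using Poly_Mapping.keys_add[of a b] by (auto simp: K_def)
    qed
  next
    fix a x :: "(real ^ 'd) \<Rightarrow>\<^sub>0 'a"
    assume "a \<in> K" "x \<in> carrier (semigroup_ring M)"
    then show "a \<otimes>\<^bsub>semigroup_ring M\<^esub> x \<in> K" "x \<otimes>\<^bsub>semigroup_ring M\<^esub> a \<in> K"
      using U_mult[of a x] by (simp_all add: K_def mult.commute)
  qed
  moreover have "S \<subseteq> K"
    unfolding K_def U_def using exponents_zero by clarify (metis add.right_neutral)
  ultimately have "genideal (semigroup_ring M) S \<subseteq> K"
    by (rule semigroup_ring.genideal_minimal)
  then show ?thesis
    using assms(2,3) unfolding K_def U_def by blast
qed

lemma monomial_ideal_ideal: "monomial_ideal M I \<Longrightarrow> ideal I (semigroup_ring M)"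
  unfolding monomial_ideal_def
  using semigroup_ring.genideal_ideal monomials_subset_carrier by blast

lemma monomial_ideal_contains_terms:
  fixes I :: "((real ^ 'd) \<Rightarrow>\<^sub>0 'a::comm_ring_1) set"
  assumes "monomial_ideal M I" "f \<in> I" "x \<in> Poly_Mapping.keys f"
  shows "monom x \<in> I"
proof -
  obtain S where S: "S \<subseteq> monomials M" "I = genideal (semigroup_ring M) S"
    using assms(1) by (auto simp: monomial_ideal_def)
  have S_carrier: "S \<subseteq> carrier (semigroup_ring M)"
    using S(1) monomials_subset_carrier by blast
  obtain s g e where s: "s \<in> S" "g \<in> Poly_Mapping.keys s" "e \<in> exponents M" "x = g + e"
    using keys_genideal[OF S_carrier] assms(2,3) S(2) by blast
  have "s = monom g"
    using s(1,2) S(1) by (auto simp: monomials_def)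
  then have "monom g \<in> I"
    using semigroup_ring.genideal_self[OF S_carrier] s(1) S(2) by blast
  then show ?thesis
    using ideal_mult_monom[OF monomial_ideal_ideal[OF assms(1)]] s(3,4) by blast
qed

lemma monomial_ideal_subset_idealI:
  assumes "monomial_ideal M J" "ideal Q (semigroup_ring M)"
    and "\<And>x. x \<in> exponents M \<Longrightarrow> monom x \<in> J \<Longrightarrow> monom x \<in> Q"
  shows "J \<subseteq> Q"
proof -
  obtain S where S: "S \<subseteq> monomials M" "J = genideal (semigroup_ring M) S"
    using assms(1) by (auto simp: monomial_ideal_def)
  then have "S \<subseteq> J"
    using semigroup_ring.genideal_self monomials_subset_carrier by blast
  then have "S \<subseteq> Q"
    using S(1) assms(3) unfolding monomials_def by blast
  then show ?thesis
    using semigroup_ring.genideal_minimal[OF assms(2)] S(2) by blast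
qed

lemma fg_monomial_ideal_dominating_monomials:
  fixes I :: "((real ^ 'd) \<Rightarrow>\<^sub>0 'a::comm_ring_1) set"
  assumes "I \<in> fg_monomial_ideals M"
  obtains G where "finite G" "G \<subseteq> exponents M" "\<And>g. g \<in> G \<Longrightarrow> monom g \<in> I"
    "\<And>x. monom x \<in> I \<Longrightarrow> \<exists>g\<in>G. \<forall>i. g $ i \<le> x $ i"
proof -
  obtain S where I: "monomial_ideal M I" and S: "S \<subseteq> carrier (semigroup_ring M)" "finite S"
    "I = genideal (semigroup_ring M) S"
    using assms by (auto simp: fg_monomial_ideals_def)
  show ?thesis
  proof (rule that[of "\<Union>s\<in>S. Poly_Mapping.keys s"])
    show "finite (\<Union>s\<in>S. Poly_Mapping.keys s)"
      using S(2) by simp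
    show "(\<Union>s\<in>S. Poly_Mapping.keys s) \<subseteq> exponents M"
      using S(1) by fastforce
    show "monom g \<in> I" if "g \<in> (\<Union>s\<in>S. Poly_Mapping.keys s)" for g
      using that monomial_ideal_contains_terms[OF I] semigroup_ring.genideal_self[OF S(1)] S(3)
      by blast
    show "\<exists>g\<in>\<Union>s\<in>S. Poly_Mapping.keys s. \<forall>i. g $ i \<le> x $ i" if x: "monom x \<in> I" for x
    proof -
      have "x \<in> Poly_Mapping.keys (monom x :: (real ^ 'd) \<Rightarrow>\<^sub>0 'a)"
        by simp
      then obtain s g e where s: "s \<in> S" "g \<in> Poly_Mapping.keys s" "e \<in> exponents M" "x = g + e"
        using keys_genideal[OF S(1)] x S(3) by blast
      moreover have "g $ i \<le> x $ i" for i
        using s(3,4) by (simp add: exponents_def)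
      ultimately show ?thesis
        by blast
    qed
  qed
qed

section \<open>Monomials in m-prime ideals\<close>

lemma m_prime_ideal: "m_prime M Q \<Longrightarrow> ideal Q (semigroup_ring M)"
  by (simp add: m_prime_def monomial_ideal_ideal)

lemma m_prime_one_notin:
  assumes "m_prime M Q"
  shows "monom 0 \<notin> Q"
  using ideal.one_imp_carrier[OF m_prime_ideal[OF assms]] assms by (auto simp: m_prime_def)

lemma m_prime_cancel:
  assumes "m_prime M Q" "x \<in> exponents M" "y \<in> exponents M" "monom (x + y) \<in> Q"
  shows "monom x \<in> Q \<or> monom y \<in> Q"
  using assms monom_in_monomials unfolding m_prime_def monom_add by blast

text \<open>
  A monomial is the product of pure powers of the variables, so primeness on monomials puts one of
  these factors into \<open>Q\<close>. Its exponent cannot vanish because \<open>Q\<close> is proper.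
\<close>

lemma m_prime_contains_pure_power:
  assumes Q: "m_prime M Q" and x: "x \<in> exponents M" "monom x \<in> Q"
  shows "\<exists>i. 0 < x $ i \<and> monom (axis i (x $ i)) \<in> Q"
proof -
  have factor: "\<exists>i\<in>F. monom (axis i (x $ i)) \<in> Q"
    if "monom (\<Sum>i\<in>F. axis i (x $ i)) \<in> Q" for F
    using finite[of F] that
  proof (induction F rule: finite_induct)
    case empty
    then show ?case
      using m_prime_one_notin[OF Q] by simp
  next
    case (insert j F)
    have "monom (axis j (x $ j) + (\<Sum>i\<in>F. axis i (x $ i))) \<in> Q"
      using insert by simp
    then have "monom (axis j (x $ j)) \<in> Q \<or> monom (\<Sum>i\<in>F. axis i (x $ i)) \<in> Q"
      by (intro m_prime_cancel[OF Q] exponents_axis[OF x(1)] exponents_sum)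
    then show ?case
      using insert.IH by blast
  qed
  have "(\<Sum>i\<in>UNIV. axis i (x $ i)) = x"
    by (simp add: vec_eq_iff axis_def)
  then obtain i where i: "monom (axis i (x $ i)) \<in> Q"
    using factor[of UNIV] x(2) by auto
  then have "x $ i \<noteq> 0"
    using m_prime_one_notin[OF Q] by (metis axis_eq_0_iff)
  moreover have "0 \<le> x $ i"
    using x(1) by (simp add: exponents_def)
  ultimately show ?thesis
    using i by (intro exI[of _ i]) auto
qed

text \<open>
  By the Archimedean property a high power of a monomial involving \<open>X\<^sub>i\<close> is divisible by any
  prescribed power of \<open>X\<^sub>i\<close>; primeness then descends from that power to the monomial itself.
\<close>

lemma m_prime_absorbs_variable:
  assumes Q: "m_prime M Q" and a: "axis i a \<in> exponents M" "monom (axis i a) \<in> Q"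
    and x: "x \<in> exponents M" "0 < x $ i"
  shows "monom x \<in> Q"
proof -
  have root: "monom x \<in> Q" if "monom (real k *\<^sub>R x) \<in> Q" for k
    using that
  proof (induction k)
    case 0
    then show ?case
      using m_prime_one_notin[OF Q] by simp
  next
    case (Suc k)
    have "monom (x + real k *\<^sub>R x) \<in> Q"
      using Suc.prems by (simp add: algebra_simps)
    then show ?case
      using m_prime_cancel[OF Q x(1) exponents_scale[OF x(1)]] Suc.IH by blast
  qed
  obtain k where k: "a < real k * x $ i"
    using reals_Archimedean3[OF x(2)] by blast
  have "real k *\<^sub>R x - axis i a \<in> exponents M"
  proof (rule exponents_diff[OF exponents_scale[OF x(1)] a(1)])
    show "axis i a $ j \<le> (real k *\<^sub>R x) $ j" for j
      using k x(1) by (auto simp: axis_def exponents_def)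
  qed
  then have "monom (axis i a + (real k *\<^sub>R x - axis i a)) \<in> Q"
    by (rule ideal_mult_monom[OF m_prime_ideal[OF Q] a(2)])
  then show ?thesis
    using root[of k] by simp
qed

section \<open>Nearby monomial ideals\<close>

text \<open>
  The radius depends on \<open>I\<close> alone and serves all m-primes above \<open>I\<close> at once, because it is chosen
  with respect to all positive coordinates of the dominating monomials.
\<close>

lemma m_primes_persist_nearby:
  fixes I :: "((real ^ 'd) \<Rightarrow>\<^sub>0 'a::comm_ring_1) set"
  assumes "I \<in> fg_monomial_ideals M"
  shows "\<exists>\<epsilon>>0. \<forall>J Q. monomial_ideal M J \<and> within_dist M I J \<epsilon> \<and> m_prime M Q \<and> I \<subseteq> Q \<longrightarrow> J \<subseteq> Q"
proof -
  obtain G where G: "finite G" "G \<subseteq> exponents M" "\<And>g. g \<in> G \<Longrightarrow> monom g \<in> I"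
    "\<And>x. monom x \<in> I \<Longrightarrow> \<exists>g\<in>G. \<forall>i. g $ i \<le> x $ i"
    using fg_monomial_ideal_dominating_monomials[OF assms] by blast
  \<comment> \<open>The element 1 keeps the set nonempty when no coordinate is positive, as for the zero ideal.\<close>
  define P where "P = insert 1 {r. 0 < r \<and> (\<exists>g\<in>G. \<exists>i. r = g $ i)}"
  have "P \<subseteq> insert 1 ((\<lambda>(g, i). g $ i) ` (G \<times> UNIV))"
    by (auto simp: P_def)
  then have "finite P"
    by (rule finite_subset) (use G(1) in simp)
  define \<epsilon> where "\<epsilon> = Min P"
  have \<epsilon>_le: "\<epsilon> \<le> g $ i" if "g \<in> G" "0 < g $ i" for g i
    unfolding \<epsilon>_def using \<open>finite P\<close> that by (intro Min_le) (auto simp: P_def)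
  have "\<epsilon> \<in> P"
    unfolding \<epsilon>_def using \<open>finite P\<close> by (intro Min_in) (auto simp: P_def)
  then have "0 < \<epsilon>"
    by (auto simp: P_def)
  moreover have "J \<subseteq> Q"
    if J: "monomial_ideal M J" "within_dist M I J \<epsilon>" and Q: "m_prime M Q" "I \<subseteq> Q"
    for J Q :: "((real ^ 'd) \<Rightarrow>\<^sub>0 'a) set"
  proof (rule monomial_ideal_subset_idealI[OF J(1) m_prime_ideal[OF Q(1)]])
    fix x assume x: "x \<in> exponents M" "monom x \<in> J"
    obtain y where y: "monom y \<in> I" "norm (x - y) < \<epsilon>"
      using J(2) x unfolding within_dist_def by blast
    obtain g where g: "g \<in> G" "\<And>i. g $ i \<le> y $ i"
      using G(4)[OF y(1)] by blast
    have g_exp: "g \<in> exponents M"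
      using g(1) G(2) by blast
    have "monom g \<in> Q"
      using G(3)[OF g(1)] Q(2) by blast
    then obtain i where i: "0 < g $ i" "monom (axis i (g $ i)) \<in> Q"
      using m_prime_contains_pure_power[OF Q(1) g_exp] by blast
    have "\<bar>x $ i - y $ i\<bar> < \<epsilon>"
      using component_le_norm_cart[of "x - y" i] y(2) by simp
    then have "0 < x $ i"
      using \<epsilon>_le[OF g(1) i(1)] g(2)[of i] by linarith
    then show "monom x \<in> Q"
      using m_prime_absorbs_variable[OF Q(1) exponents_axis[OF g_exp] i(2) x(1)] by blast
  qed
  ultimately show ?thesis
    by blast
qed

end

lemma within_dist_mono: "within_dist M I J \<delta> \<Longrightarrow> \<delta> \<le> \<epsilon> \<Longrightarrow> within_dist M I J \<epsilon>"
  unfolding within_dist_def by (fast intro: less_le_trans)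

lemma within_dist_if_ideal_dist_less:
  assumes "ideal_dist M I J < ereal \<epsilon>"
  shows "within_dist M I J \<epsilon>"
proof -
  obtain \<delta> where "\<delta> < \<epsilon>" "within_dist M I J \<delta>"
    using assms by (auto simp: ideal_dist_def Inf_less_iff)
  then show ?thesis
    by (auto intro: within_dist_mono)
qed

theorem corollary4p15:
  fixes M :: "'d::finite \<Rightarrow> real set"
  assumes "\<And>i. additive_real_subgroup (M i)"
    and "\<And>i. M i \<noteq> {0}"
  shows "lower_semicontinuous_wrt (ideal_dist M)
           (fg_monomial_ideals M :: ((real ^ 'd) \<Rightarrow>\<^sub>0 'a::comm_ring_1) set set) (m_dim M)"
  unfolding lower_semicontinuous_wrt_def
proof
  fix I :: "((real ^ 'd) \<Rightarrow>\<^sub>0 'a) set"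
  assume I: "I \<in> fg_monomial_ideals M"
  have "\<exists>\<epsilon>>0. \<forall>J Q. monomial_ideal M J \<and> within_dist M I J \<epsilon> \<and> m_prime M Q \<and> I \<subseteq> Q \<longrightarrow> J \<subseteq> Q"
    by (rule m_primes_persist_nearby[OF _ I]) (rule assms(1))
  then obtain \<epsilon> where \<epsilon>: "0 < \<epsilon>"
    "\<And>J Q. monomial_ideal M J \<Longrightarrow> within_dist M I J \<epsilon> \<Longrightarrow> m_prime M Q \<Longrightarrow> I \<subseteq> Q \<Longrightarrow> J \<subseteq> Q"
    by metis
  have "m_dim M I \<le> m_dim M J" if "J \<in> fg_monomial_ideals M" "ideal_dist M I J < ereal \<epsilon>" for J
  proof -
    have "monomial_ideal M J"
      using that(1) by (simp add: fg_monomial_ideals_def)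
    then have "{Q. m_prime M Q \<and> I \<subseteq> Q} \<subseteq> {Q. m_prime M Q \<and> J \<subseteq> Q}"
      using \<epsilon>(2) within_dist_if_ideal_dist_less[OF that(2)] by blast
    then show ?thesis
      unfolding m_dim_def by (rule SUP_subset_mono) simp
  qed
  then show "\<exists>\<epsilon>>0. \<forall>J\<in>fg_monomial_ideals M. ideal_dist M I J < ereal \<epsilon> \<longrightarrow> m_dim M I \<le> m_dim M J"
    using \<epsilon>(1) by blast
qed

end
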